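(* Let $P$ be a poset that is a $K_D$ poset and is co-sober in its Scott topology. Then $P$ is a $\mathcal Q_{\sigma}$-unique poset; that is, for every poset $M$, if $(\mathcal Q(P),\supseteq)$ and $(\mathcal Q(M),\supseteq)$ are order isomorphic, then $P$ and $M$ are order isomorphic.
   Context: For a poset $P$ and $A\subseteq P$, ${\uparrow}A=\{x\in P: x\ge a \text{ for some } a\in A\}$ and ${\uparrow}x={\uparrow}\{x\}$; $A$ is an upper set if $A={\uparrow}A$. A subset $D\subseteq P$ is directed if every finite subset of $D$ (including the empty one) has an upper bound in $D$. A subset $U\subseteq P$ is Scott open if $U={\uparrow}U$ and for every directed $D\subseteq P$ whose supremum exists, $\sup D\in U$ implies $D\cap U\ne\emptyset$; the Scott open sets form the Scott topology. $\mathcal Q(P)$ denotes the set of all compact saturated subsets of $P$ with respect to the Scott topology (saturated means upper set; compact means every open cover has a finite subcover; the empty set is included), ordered by reverse inclusion. $P$ is a $K_D$ poset if for every $x\in P$ the set ${\uparrow}x\setminus\{x\}$ is compact in the Scott topology of $P$. A nonempty compact saturated subset $K$ of a space is $k$-irreducible if it cannot be written as the union of two proper compact saturated subsets (i.e. two compact saturated sets each properly contained in $K$). A space is co-sober if every $k$-irreducible compact saturated subset is the saturation of a point; for the Scott topology on $P$ this means it equals ${\uparrow}x$ for some $x\in P$. *)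

theory Defs
  imports "HOL-Analysis.Abstract_Topology"
begin

(* A poset is a relation r with Partial_order r; its carrier is Field r, and (x, y) \<in> r means
   x \<le> y.  The relational form (rather than the type class order) also covers the empty poset. *)

(* Since r \<subseteq> Field r \<times> Field r, the image r `` A is the upward closure of A, and the equation
   forces A \<subseteq> Field r. *)
definition upper_set :: "'a rel \<Rightarrow> 'a set \<Rightarrow> bool" where
  "upper_set r A \<longleftrightarrow> A = r `` A"

(* The case F = {} makes directed sets nonempty. *)
definition directed_set :: "'a rel \<Rightarrow> 'a set \<Rightarrow> bool" where
  "directed_set r D \<longleftrightarrow>
     D \<subseteq> Field r \<and> (\<forall>F. finite F \<and> F \<subseteq> D \<longrightarrow> (\<exists>u\<in>D. \<forall>x\<in>F. (x, u) \<in> r))"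

definition is_supremum :: "'a rel \<Rightarrow> 'a set \<Rightarrow> 'a \<Rightarrow> bool" where
  "is_supremum r D s \<longleftrightarrow> s \<in> Above r D \<and> (\<forall>u\<in>Above r D. (s, u) \<in> r)"

definition scott_open :: "'a rel \<Rightarrow> 'a set \<Rightarrow> bool" where
  "scott_open r U \<longleftrightarrow>
     upper_set r U \<and>
     (\<forall>D s. directed_set r D \<and> is_supremum r D s \<and> s \<in> U \<longrightarrow> D \<inter> U \<noteq> {})"

definition scott_topology :: "'a rel \<Rightarrow> 'a topology" where
  "scott_topology r = topology (scott_open r)"

definition compact_saturated_sets :: "'a rel \<Rightarrow> 'a set set" where
  "compact_saturated_sets r = {K. compactin (scott_topology r) K \<and> upper_set r K}"

(* Reverse inclusion: K lies below L iff K \<supseteq> L. *)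
definition Q_order :: "'a rel \<Rightarrow> 'a set rel" where
  "Q_order r = relation_of (\<lambda>K L. K \<supseteq> L) (compact_saturated_sets r)"

definition K_D_poset :: "'a rel \<Rightarrow> bool" where
  "K_D_poset r \<longleftrightarrow>
     Partial_order r \<and> (\<forall>x\<in>Field r. compactin (scott_topology r) (above r x - {x}))"

definition k_irreducible :: "'a rel \<Rightarrow> 'a set \<Rightarrow> bool" where
  "k_irreducible r K \<longleftrightarrow>
     K \<in> compact_saturated_sets r \<and> K \<noteq> {} \<and>
     \<not> (\<exists>A\<in>compact_saturated_sets r. \<exists>B\<in>compact_saturated_sets r.
           A \<subset> K \<and> B \<subset> K \<and> K = A \<union> B)"

definition co_sober :: "'a rel \<Rightarrow> bool" where
  "co_sober r \<longleftrightarrow> (\<forall>K. k_irreducible r K \<longrightarrow> (\<exists>x\<in>Field r. K = above r x))"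

(* The library's iso is stated via initial segments; see order_isomorphic_iff for the usual form. *)
definition order_isomorphic :: "'a rel \<Rightarrow> 'b rel \<Rightarrow> bool" where
  "order_isomorphic r s \<longleftrightarrow> (\<exists>f. iso r s f)"

lemma order_isomorphic_iff:
  "order_isomorphic r s \<longleftrightarrow>
     (\<exists>f. bij_betw f (Field r) (Field s) \<and>
          (\<forall>x\<in>Field r. \<forall>y\<in>Field r. (x, y) \<in> r \<longleftrightarrow> (f x, f y) \<in> s))"
  by (simp add: order_isomorphic_def iso_iff2)

lemma upper_setD: "upper_set r A \<Longrightarrow> r `` A = A"
  unfolding upper_set_def by (rule sym)

lemma directed_setD:
  assumes "directed_set r D" "finite F" "F \<subseteq> D"
  obtains u where "u \<in> D" "\<forall>x\<in>F. (x, u) \<in> r"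
  using assms(1)[unfolded directed_set_def, THEN conjunct2, THEN spec, of F] assms(2,3) by auto

lemma scott_open_upper: "scott_open r U \<Longrightarrow> upper_set r U"
  by (simp add: scott_open_def)

lemma scott_openI:
  assumes "upper_set r U"
    and "\<And>D s. \<lbrakk>directed_set r D; is_supremum r D s; s \<in> U\<rbrakk> \<Longrightarrow> D \<inter> U \<noteq> {}"
  shows "scott_open r U"
  using assms by (auto simp only: scott_open_def)

lemma scott_openD:
  assumes "scott_open r U" "directed_set r D" "is_supremum r D s" "s \<in> U"
  shows "D \<inter> U \<noteq> {}"
  using assms(1)[unfolded scott_open_def, THEN conjunct2, rule_format, of D s] assms(2-4) by simp

lemma istopology_scott_open:
  assumes "Partial_order r"
  shows "istopology (scott_open r)"
  unfolding istopology_def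
proof (intro conjI allI impI)
  have rf: "refl_on (Field r) r"
    using assms by (simp add: order_on_defs)
  fix S T
  assume ST: "scott_open r S" "scott_open r T"
  have S: "r `` S = S" by (rule upper_setD[OF scott_open_upper[OF ST(1)]])
  have T: "r `` T = T" by (rule upper_setD[OF scott_open_upper[OF ST(2)]])
  have "S \<inter> T \<subseteq> r `` (S \<inter> T)"
  proof
    fix x assume x: "x \<in> S \<inter> T"
    then have "x \<in> r `` S" by (simp add: S)
    then have "x \<in> Field r" by (auto simp: Field_def)
    then have "(x, x) \<in> r" using rf by (simp add: refl_on_def)
    then show "x \<in> r `` (S \<inter> T)" by (rule ImageI) (rule x)
  qed
  moreover have "r `` (S \<inter> T) \<subseteq> r `` S \<inter> r `` T" by (rule Image_Int_subset)
  ultimately have "upper_set r (S \<inter> T)"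
    unfolding upper_set_def S T by (rule equalityI)
  moreover have "D \<inter> (S \<inter> T) \<noteq> {}"
    if D: "directed_set r D" and s: "is_supremum r D s" "s \<in> S \<inter> T" for D s
  proof -
    have "D \<inter> S \<noteq> {}" "D \<inter> T \<noteq> {}"
      using ST[THEN scott_openD, OF D s(1)] s(2) by simp_all
    then obtain a b where ab: "a \<in> D" "a \<in> S" "b \<in> D" "b \<in> T" by blast
    have "finite {a, b}" "{a, b} \<subseteq> D" using ab by simp_all
    then obtain u where u: "u \<in> D" "\<forall>x\<in>{a, b}. (x, u) \<in> r"
      by (rule directed_setD[OF D])
    have "u \<in> r `` S" by (rule ImageI[OF bspec[OF u(2)] ab(2)]) simp
    moreover have "u \<in> r `` T" by (rule ImageI[OF bspec[OF u(2)] ab(4)]) simp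
    ultimately show ?thesis using u(1) unfolding S T by (simp add: disjoint_iff) metis
  qed
  ultimately show "scott_open r (S \<inter> T)"
    by (rule scott_openI)
next
  fix \<K>
  assume K: "\<forall>S\<in>\<K>. scott_open r S"
  have "r `` \<Union>\<K> = (\<Union>S\<in>\<K>. r `` S)" by auto
  also have "\<dots> = (\<Union>S\<in>\<K>. S)"
  proof (rule SUP_cong[OF HOL.refl])
    fix S assume "S \<in> \<K>"
    with K show "r `` S = S" by (intro upper_setD scott_open_upper) (rule bspec)
  qed
  finally have "upper_set r (\<Union>\<K>)" by (simp add: upper_set_def)
  moreover have "D \<inter> \<Union>\<K> \<noteq> {}"
    if D: "directed_set r D" "is_supremum r D s" and s: "s \<in> \<Union>\<K>" for D s
  proof -
    obtain S where S: "S \<in> \<K>" "s \<in> S" using s by blast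
    have "D \<inter> S \<noteq> {}" by (rule scott_openD[OF bspec[OF K S(1)] D S(2)])
    then show ?thesis using S(1) by blast
  qed
  ultimately show "scott_open r (\<Union>\<K>)"
    by (rule scott_openI)
qed

lemma openin_scott_topology:
  assumes "Partial_order r"
  shows "openin (scott_topology r) U \<longleftrightarrow> scott_open r U"
  by (simp add: scott_topology_def istopology_scott_open[OF assms])

lemma topspace_scott_topology:
  assumes "Partial_order r"
  shows "topspace (scott_topology r) = Field r"
proof (rule equalityI)
  have "scott_open r (topspace (scott_topology r))"
    using openin_topspace[of "scott_topology r"] by (simp only: openin_scott_topology[OF assms])
  then have "topspace (scott_topology r) = r `` topspace (scott_topology r)"
    by (rule upper_setD[OF scott_open_upper, THEN sym])
  also have "\<dots> \<subseteq> Field r" by (auto simp: Field_def)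
  finally show "topspace (scott_topology r) \<subseteq> Field r" .
next
  have "r `` Field r = Field r"
    using assms by (auto simp: order_on_defs refl_on_def Field_def)
  moreover have "D \<inter> Field r \<noteq> {}" if D: "directed_set r D" for D
  proof -
    obtain u where "u \<in> D" by (rule directed_setD[OF D finite.emptyI empty_subsetI])
    moreover have "D \<subseteq> Field r" using D by (simp add: directed_set_def)
    ultimately show ?thesis by blast
  qed
  ultimately have "openin (scott_topology r) (Field r)"
    by (simp add: openin_scott_topology[OF assms] scott_open_def upper_set_def)
  then show "Field r \<subseteq> topspace (scott_topology r)" by (rule openin_subset)
qed

lemma Field_Q_order: "Field (Q_order r) = compact_saturated_sets r"
  by (auto simp: Q_order_def relation_of_def Field_def)

lemma Partial_order_Q_order: "Partial_order (Q_order r)"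
  unfolding Field_Q_order
  by (auto simp: order_on_defs Q_order_def relation_of_def refl_on_def
      intro!: transI antisymI)

end

theory Submission
  imports Defs
begin

text \<open>
  Inside \<open>\<Q>(P)\<close> the poset \<open>P\<close> sits, with its order, as the family of principal upper
  sets \<open>\<up>x\<close>. It therefore suffices that every order isomorphism \<open>\<phi>\<close> from \<open>\<Q>(P)\<close> to \<open>\<Q>(M)\<close> maps
  the principal upper sets of \<open>P\<close> exactly onto those of \<open>M\<close>. The two hypotheses on \<open>P\<close> give one
  inclusion each.

  A principal upper set is \<open>k\<close>-irreducible, and \<open>k\<close>-irreducibility is an order-theoretic notion,
  because unions are binary joins with respect to inclusion. So \<open>\<phi>\<^sup>-\<^sup>1(\<up>y)\<close> is \<open>k\<close>-irreducible for each \<open>y\<close> in \<open>M\<close>, and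
  co-sobriety makes it principal.

  Conversely, the \<open>K\<^sub>D\<close> property says that \<open>\<up>x\<close> has a largest proper compact saturated subset,
  namely \<open>\<up>x - {x}\<close>, and having one is again order-theoretic. In any poset a compact saturated set
  \<open>K\<close> with a largest proper compact saturated subset \<open>L\<close> is principal: a point \<open>y\<close> of \<open>K - L\<close>
  satisfies \<open>\<up>y \<subseteq> K\<close> but not \<open>\<up>y \<subseteq> L\<close>, which leaves only \<open>\<up>y = K\<close>. Hence \<open>\<phi>(\<up>x)\<close> is principal.
\<close>

lemma above_subset_above_iff:
  assumes "Partial_order r" "x \<in> Field r" "y \<in> Field r"
  shows "above r y \<subseteq> above r x \<longleftrightarrow> (x, y) \<in> r"
proof
  assume "above r y \<subseteq> above r x"
  moreover have "y \<in> above r y"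
    using assms by (auto simp: above_def order_on_defs refl_on_def)
  ultimately show "(x, y) \<in> r"
    by (auto simp: above_def)
next
  assume "(x, y) \<in> r"
  then show "above r y \<subseteq> above r x"
    using assms(1) by (auto simp: above_def order_on_defs dest: transD)
qed

lemma inj_on_above:
  assumes "Partial_order r"
  shows "inj_on (above r) (Field r)"
proof (rule inj_onI)
  fix x y assume "x \<in> Field r" "y \<in> Field r" "above r x = above r y"
  then have "(x, y) \<in> r" "(y, x) \<in> r"
    using above_subset_above_iff[OF assms] by blast+
  then show "x = y"
    using assms by (auto simp: order_on_defs dest: antisymD)
qed

lemma self_in_above:
  assumes "Partial_order r" "x \<in> Field r"
  shows "x \<in> above r x"
  using assms by (auto simp: above_def order_on_defs refl_on_def)

lemma above_subset_upper_set:
  assumes "upper_set r K" "x \<in> K"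
  shows "above r x \<subseteq> K"
  using upper_setD[OF assms(1)] assms(2) by (auto simp: above_def)

lemma compact_saturated_subset_Field:
  assumes "K \<in> compact_saturated_sets r"
  shows "K \<subseteq> Field r"
proof -
  have "r `` K = K"
    using assms by (simp add: compact_saturated_sets_def upper_setD)
  then show ?thesis
    by (auto simp: Field_def)
qed

lemma upper_setI:
  assumes "Partial_order r" "K \<subseteq> Field r" "\<And>x y. x \<in> K \<Longrightarrow> (x, y) \<in> r \<Longrightarrow> y \<in> K"
  shows "upper_set r K"
  using assms by (auto simp: upper_set_def order_on_defs refl_on_def)

lemma empty_compact_saturated: "{} \<in> compact_saturated_sets r"
  by (simp add: compact_saturated_sets_def upper_set_def)

lemma Un_compact_saturated:
  assumes "A \<in> compact_saturated_sets r" "B \<in> compact_saturated_sets r"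
  shows "A \<union> B \<in> compact_saturated_sets r"
proof -
  have "r `` (A \<union> B) = A \<union> B"
    using assms by (simp add: compact_saturated_sets_def Image_Un upper_setD)
  then have "upper_set r (A \<union> B)"
    unfolding upper_set_def by (rule sym)
  then show ?thesis
    using assms by (simp add: compact_saturated_sets_def compactin_Un)
qed

text \<open>A member of an open cover that contains \<open>x\<close> already contains all of \<open>\<up>x\<close>.\<close>

lemma above_compact_saturated:
  assumes "Partial_order r" "x \<in> Field r"
  shows "above r x \<in> compact_saturated_sets r"
proof -
  have sub: "above r x \<subseteq> Field r"
    by (auto simp: above_def Field_def)
  have "upper_set r (above r x)"
    using assms(1) sub
    by (rule upper_setI) (use assms(1) in \<open>auto simp: above_def order_on_defs dest: transD\<close>)
  moreover have "compactin (scott_topology r) (above r x)"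
    unfolding compactin_def
  proof (intro conjI allI impI)
    show "above r x \<subseteq> topspace (scott_topology r)"
      by (simp add: topspace_scott_topology[OF assms(1)] sub)
    fix \<U>
    assume \<U>: "(\<forall>U\<in>\<U>. openin (scott_topology r) U) \<and> above r x \<subseteq> \<Union>\<U>"
    then obtain U where U: "U \<in> \<U>" "x \<in> U"
      using self_in_above[OF assms] by blast
    then have "upper_set r U"
      using \<U> by (auto simp: openin_scott_topology[OF assms(1)] intro: scott_open_upper)
    then have "above r x \<subseteq> U"
      using U(2) by (rule above_subset_upper_set)
    then show "\<exists>\<F>. finite \<F> \<and> \<F> \<subseteq> \<U> \<and> above r x \<subseteq> \<Union>\<F>"
      using U(1) by (intro exI[of _ "{U}"]) auto
  qed
  ultimately show ?thesis
    by (simp add: compact_saturated_sets_def)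
qed

text \<open>If \<open>\<up>x = A \<union> B\<close> then \<open>x\<close> lies in one of the two upper sets, which is then all of \<open>\<up>x\<close>.\<close>

lemma k_irreducible_above:
  assumes "Partial_order r" "x \<in> Field r"
  shows "k_irreducible r (above r x)"
  unfolding k_irreducible_def
proof (intro conjI notI)
  show "above r x \<in> compact_saturated_sets r"
    using assms by (rule above_compact_saturated)
  show "False" if "above r x = {}"
    using that self_in_above[OF assms] by blast
  assume "\<exists>A\<in>compact_saturated_sets r. \<exists>B\<in>compact_saturated_sets r.
    A \<subset> above r x \<and> B \<subset> above r x \<and> above r x = A \<union> B"
  then obtain A B where AB: "upper_set r A" "upper_set r B"
    "A \<subset> above r x" "B \<subset> above r x" "above r x = A \<union> B"
    unfolding compact_saturated_sets_def by blast
  then have "x \<in> A \<or> x \<in> B"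
    using self_in_above[OF assms] by blast
  then have "above r x \<subseteq> A \<or> above r x \<subseteq> B"
    using above_subset_upper_set[OF AB(1)] above_subset_upper_set[OF AB(2)] by blast
  then show False
    using AB(3,4) by blast
qed

text \<open>
  Together with the lemma after it, this turns the \<open>K\<^sub>D\<close> property into an order-theoretic one:
  an upper set properly inside \<open>\<up>x\<close> must omit \<open>x\<close>, so \<open>\<up>x - {x}\<close> is the largest proper compact
  saturated subset of \<open>\<up>x\<close>.
\<close>

lemma K_D_above_minus_compact_saturated:
  assumes "K_D_poset r" "x \<in> Field r"
  shows "above r x - {x} \<in> compact_saturated_sets r"
proof -
  have po: "Partial_order r" and "compactin (scott_topology r) (above r x - {x})"
    using assms by (auto simp: K_D_poset_def)
  moreover have "upper_set r (above r x - {x})"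
  proof (rule upper_setI[OF po])
    show "above r x - {x} \<subseteq> Field r"
      by (auto simp: above_def Field_def)
    fix u v assume "u \<in> above r x - {x}" "(u, v) \<in> r"
    then show "v \<in> above r x - {x}"
      using po by (auto simp: above_def order_on_defs dest: transD antisymD)
  qed
  ultimately show ?thesis
    by (simp add: compact_saturated_sets_def)
qed

lemma compact_saturated_psubset_above:
  assumes "A \<in> compact_saturated_sets r" "A \<subset> above r x"
  shows "A \<subseteq> above r x - {x}"
  using assms above_subset_upper_set[of r A x] by (auto simp: compact_saturated_sets_def)

text \<open>
  Any point \<open>y\<close> of \<open>K - L\<close> generates \<open>K\<close>: otherwise \<open>\<up>y\<close> would be a proper compact saturated subset
  of \<open>K\<close>, hence contained in \<open>L\<close>.
\<close>

lemma principal_if_largest_proper_subset: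
  assumes "Partial_order r"
    and "K \<in> compact_saturated_sets r" "L \<subset> K"
    and largest: "\<And>A. A \<in> compact_saturated_sets r \<Longrightarrow> A \<subset> K \<Longrightarrow> A \<subseteq> L"
  shows "\<exists>y\<in>Field r. K = above r y"
proof -
  obtain y where y: "y \<in> K" "y \<notin> L"
    using assms(3) by blast
  then have yF: "y \<in> Field r"
    using compact_saturated_subset_Field[OF assms(2)] by blast
  have "above r y \<subseteq> K"
    using assms(2) y(1) by (auto simp: compact_saturated_sets_def dest: above_subset_upper_set)
  moreover have "\<not> above r y \<subseteq> L"
    using self_in_above[OF assms(1) yF] y(2) by blast
  ultimately have "K = above r y"
    using largest[OF above_compact_saturated[OF assms(1) yF]] by blast
  then show ?thesis
    using yF by blast
qed

text \<open>
  With respect to inclusion, the union is the join of two compact saturated sets and the empty set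
  is the least of them, so \<open>k\<close>-irreducibility only depends on the order: a decomposition of \<open>\<phi> K\<close>
  pulls back to one of \<open>K\<close>.
\<close>

lemma k_irreducible_image:
  assumes bij: "bij_betw \<phi> (compact_saturated_sets r) (compact_saturated_sets s)"
    and mono: "\<And>A B. A \<in> compact_saturated_sets r \<Longrightarrow> B \<in> compact_saturated_sets r \<Longrightarrow>
      A \<subseteq> B \<longleftrightarrow> \<phi> A \<subseteq> \<phi> B"
    and irr: "k_irreducible r K"
  shows "k_irreducible s (\<phi> K)"
  unfolding k_irreducible_def
proof (intro conjI notI)
  have K: "K \<in> compact_saturated_sets r" "K \<noteq> {}"
    using irr by (auto simp: k_irreducible_def)
  show "\<phi> K \<in> compact_saturated_sets s"
    using bij K(1) by (rule bij_betwE[THEN bspec])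
  show False if "\<phi> K = {}"
    using mono[OF K(1) empty_compact_saturated] K(2) that by simp
  assume "\<exists>A\<in>compact_saturated_sets s. \<exists>B\<in>compact_saturated_sets s.
    A \<subset> \<phi> K \<and> B \<subset> \<phi> K \<and> \<phi> K = A \<union> B"
  then obtain A B where A: "A \<in> compact_saturated_sets r" "\<phi> A \<subset> \<phi> K"
    and B: "B \<in> compact_saturated_sets r" "\<phi> B \<subset> \<phi> K" and un: "\<phi> K = \<phi> A \<union> \<phi> B"
    unfolding bij_betw_imp_surj_on[OF bij, symmetric] bex_simps by blast
  have AB: "A \<union> B \<in> compact_saturated_sets r"
    using A(1) B(1) by (rule Un_compact_saturated)
  have sub: "A \<subset> K" "B \<subset> K"
    using mono[OF A(1) K(1)] mono[OF B(1) K(1)] A(2) B(2) by auto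
  have "\<phi> A \<subseteq> \<phi> (A \<union> B)" "\<phi> B \<subseteq> \<phi> (A \<union> B)"
    using mono[OF A(1) AB] mono[OF B(1) AB] by auto
  then have "K \<subseteq> A \<union> B"
    using mono[OF K(1) AB] un by simp
  with sub have "K = A \<union> B"
    by blast
  with sub A(1) B(1) irr show False
    unfolding k_irreducible_def by blast
qed

theorem theorem3p17:
  fixes P :: "'a rel" and M :: "'b rel"
  assumes "Partial_order P"
    and "K_D_poset P"
    and "co_sober P"
    and "Partial_order M"
    and "order_isomorphic (Q_order P) (Q_order M)"
  shows "order_isomorphic P M"
proof -
  let ?QP = "compact_saturated_sets P" and ?QM = "compact_saturated_sets M"
  obtain \<phi> where bij: "bij_betw \<phi> ?QP ?QM"
    and "\<forall>A\<in>?QP. \<forall>B\<in>?QP. (A, B) \<in> Q_order P \<longleftrightarrow> (\<phi> A, \<phi> B) \<in> Q_order M"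
    using assms(5) unfolding order_isomorphic_iff Field_Q_order by blast
  then have mono: "A \<subseteq> B \<longleftrightarrow> \<phi> A \<subseteq> \<phi> B" if "A \<in> ?QP" "B \<in> ?QP" for A B
    using that bij_betwE[OF bij] by (auto simp: Q_order_def relation_of_def)
  define \<psi> where "\<psi> = inv_into ?QP \<phi>"
  have bij': "bij_betw \<psi> ?QM ?QP"
    unfolding \<psi>_def using bij by (rule bij_betw_inv_into)
  have \<phi>\<psi>: "\<phi> (\<psi> A) = A" if "A \<in> ?QM" for A
    unfolding \<psi>_def using bij that by (rule bij_betw_inv_into_right)
  have mono': "A \<subseteq> B \<longleftrightarrow> \<psi> A \<subseteq> \<psi> B" if "A \<in> ?QM" "B \<in> ?QM" for A B
    using mono[of "\<psi> A" "\<psi> B"] that bij_betwE[OF bij'] by (simp add: \<phi>\<psi>)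

  \<comment> \<open>\<open>\<phi>\<close> carries the largest proper subset \<open>\<up>x - {x}\<close> of \<open>\<up>x\<close> to a largest proper subset of the image.\<close>
  have "\<phi> (above P x) \<in> above M ` Field M" if x: "x \<in> Field P" for x
  proof -
    let ?K = "above P x" and ?L = "above P x - {x}"
    have K: "?K \<in> ?QP" and L: "?L \<in> ?QP"
      using above_compact_saturated[OF assms(1) x]
        K_D_above_minus_compact_saturated[OF assms(2) x] by simp_all
    have "\<phi> ?L \<subset> \<phi> ?K"
      using mono[OF L K] mono[OF K L] self_in_above[OF assms(1) x] by auto
    moreover have "A \<subseteq> \<phi> ?L" if A: "A \<in> ?QM" "A \<subset> \<phi> ?K" for A
    proof -
      have \<psi>A: "\<psi> A \<in> ?QP"
        using bij' A(1) by (rule bij_betwE[THEN bspec])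
      then have "\<psi> A \<subset> ?K"
        using mono[OF \<psi>A K] mono[OF K \<psi>A] A by (auto simp: \<phi>\<psi>)
      with \<psi>A have "\<psi> A \<subseteq> ?L"
        by (rule compact_saturated_psubset_above)
      then show ?thesis
        using mono[OF \<psi>A L] A(1) by (simp add: \<phi>\<psi>)
    qed
    ultimately have "\<exists>y\<in>Field M. \<phi> ?K = above M y"
      using bij_betwE[OF bij] K by (intro principal_if_largest_proper_subset[OF assms(4)]) auto
    then show ?thesis
      by blast
  qed
  moreover have "above M y \<in> \<phi> ` above P ` Field P" if y: "y \<in> Field M" for y
  proof -
    have "k_irreducible P (\<psi> (above M y))"
      using bij' mono' k_irreducible_above[OF assms(4) y] by (rule k_irreducible_image)
    then obtain x where "x \<in> Field P" "\<psi> (above M y) = above P x"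
      using assms(3) by (auto simp: co_sober_def)
    then show ?thesis
      using \<phi>\<psi>[OF above_compact_saturated[OF assms(4) y]] by (metis imageI)
  qed
  ultimately have img: "\<phi> ` above P ` Field P = above M ` Field M"
    by blast

  define f where "f = inv_into (Field M) (above M) \<circ> (\<phi> \<circ> above P)"
  have inj: "inj_on (\<phi> \<circ> above P) (Field P)"
    using inj_on_above[OF assms(1)] bij_betw_imp_inj_on[OF bij]
      above_compact_saturated[OF assms(1)]
    by (intro comp_inj_on) (auto elim: inj_on_subset)
  have "bij_betw (\<phi> \<circ> above P) (Field P) (above M ` Field M)"
    using inj img by (simp add: bij_betw_def image_comp)
  moreover have "bij_betw (inv_into (Field M) (above M)) (above M ` Field M) (Field M)"
    using inj_on_above[OF assms(4)] by (simp add: bij_betw_inv_into inj_on_imp_bij_betw)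
  ultimately have f: "bij_betw f (Field P) (Field M)"
    unfolding f_def by (rule bij_betw_trans)
  have above_f: "above M (f x) = \<phi> (above P x)" if "x \<in> Field P" for x
    using img that unfolding f_def comp_def by (intro f_inv_into_f) blast
  have "(x, y) \<in> P \<longleftrightarrow> (f x, f y) \<in> M" if "x \<in> Field P" "y \<in> Field P" for x y
  proof -
    have "(x, y) \<in> P \<longleftrightarrow> above P y \<subseteq> above P x"
      using above_subset_above_iff[OF assms(1)] that by blast
    also have "\<dots> \<longleftrightarrow> above M (f y) \<subseteq> above M (f x)"
      using mono above_compact_saturated[OF assms(1)] that by (simp add: above_f)
    also have "\<dots> \<longleftrightarrow> (f x, f y) \<in> M"
      using above_subset_above_iff[OF assms(4)] bij_betwE[OF f] that by blast
    finally show ?thesis .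
  qed
  with f show ?thesis
    unfolding order_isomorphic_iff by blast
qed

end
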